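(* Let $\mathbb{K}=\mathbb{R}$ or $\mathbb{C}$, let a positive integer $m$ and $\epsilon>0$ be given. There is a positive integer $N$ such that for all positive integers $n_1,\ldots,n_m$ with \[ \max_{i=1,\ldots,m}\left\{\min\{n_{j}:j\neq i\}\right\}>N \] there is an $m$-linear form $A_{n_{1},\ldots,n_{m}}\colon\ell_{\infty}^{n_{1}}\times\cdots\times\ell_{\infty}^{n_{m}}\to\mathbb{K}$ of the type \[ A_{n_{1},\ldots,n_{m}}(z^{(1)},\ldots,z^{(m)})=\sum_{j_{1}=1}^{n_{1}}\cdots\sum_{j_{m}=1}^{n_{m}}\pm z_{j_{1}}^{(1)}\cdots z_{j_{m}}^{(m)} \] such that \[ \Vert A_{n_{1},\ldots,n_{m}}\Vert\leq(1+\epsilon)\max\{n_{1}^{1/2},\ldots,n_{m}^{1/2}\}\prod_{j=1}^{m}n_{j}^{1/2}. \]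
   Context: $\ell_{\infty}^{n}$ denotes $\mathbb{K}^{n}$ with the sup-norm. "Of the type $\sum\pm\cdots$" means each coefficient of $z_{j_1}^{(1)}\cdots z_{j_m}^{(m)}$ lies in $\{-1,1\}$. The norm of an $m$-linear form is the supremum of $|A(x^{(1)},\ldots,x^{(m)})|$ over all $x^{(k)}$ in the closed unit balls. *)

theory Defs
  imports Complex_Main "HOL-Library.FuncSet" "HOL-Library.Extended_Nat"
begin

text \<open>The dimensions vary inside the statement, so a vector of \<open>K^n\<close> is a function on \<open>nat\<close>
  vanishing outside \<open>{1..n}\<close>; coordinates and factors are numbered from 1.\<close>

definition linf_space :: "nat \<Rightarrow> (nat \<Rightarrow> 'a::real_normed_field) set" where
  "linf_space n = {x. \<forall>j. j \<notin> {1..n} \<longrightarrow> x j = 0}"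

text \<open>Only meaningful for \<open>n \<ge> 1\<close> (for \<open>n = 0\<close> it is a maximum over the empty set).\<close>

definition linf_norm :: "nat \<Rightarrow> (nat \<Rightarrow> 'a::real_normed_field) \<Rightarrow> real" where
  "linf_norm n x = (MAX j\<in>{1..n}. norm (x j))"

definition linf_prod :: "nat \<Rightarrow> (nat \<Rightarrow> nat) \<Rightarrow> (nat \<Rightarrow> nat \<Rightarrow> 'a::real_normed_field) set" where
  "linf_prod m n = (\<Pi>\<^sub>E k\<in>{1..m}. linf_space (n k))"

definition multilinear_form ::
  "nat \<Rightarrow> (nat \<Rightarrow> nat) \<Rightarrow> ((nat \<Rightarrow> nat \<Rightarrow> 'a::real_normed_field) \<Rightarrow> 'a) \<Rightarrow> bool" where
  "multilinear_form m n A \<longleftrightarrow>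
     (\<forall>x\<in>linf_prod m n. \<forall>k\<in>{1..m}. \<forall>u\<in>linf_space (n k). \<forall>v\<in>linf_space (n k). \<forall>c.
        A (x(k := (\<lambda>j. u j + v j))) = A (x(k := u)) + A (x(k := v)) \<and>
        A (x(k := (\<lambda>j. c * u j))) = c * A (x(k := u)))"

text \<open>The supremum is taken in the reals; multilinear forms on finite-dimensional spaces are
  bounded on the product of the unit balls, so it is the true supremum for them.\<close>

definition form_norm ::
  "nat \<Rightarrow> (nat \<Rightarrow> nat) \<Rightarrow> ((nat \<Rightarrow> nat \<Rightarrow> 'a::real_normed_field) \<Rightarrow> 'a) \<Rightarrow> real" where
  "form_norm m n A =
     (SUP x\<in>{x \<in> linf_prod m n. \<forall>k\<in>{1..m}. linf_norm (n k) (x k) \<le> 1}. norm (A x))"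

text \<open>The iterated sum over \<open>j_1, \<dots>, j_m\<close> is written as one sum over the multi-indices \<open>j\<close>.\<close>

definition sign_type ::
  "nat \<Rightarrow> (nat \<Rightarrow> nat) \<Rightarrow> ((nat \<Rightarrow> nat \<Rightarrow> 'a::real_normed_field) \<Rightarrow> 'a) \<Rightarrow> bool" where
  "sign_type m n A \<longleftrightarrow>
     (\<exists>s. (\<forall>j\<in>(\<Pi>\<^sub>E k\<in>{1..m}. {1..n k}). s j \<in> {-1, 1}) \<and>
          (\<forall>z\<in>linf_prod m n.
             A z = (\<Sum>j\<in>(\<Pi>\<^sub>E k\<in>{1..m}. {1..n k}). s j * (\<Prod>k\<in>{1..m}. z k (j k)))))"

text \<open>\<open>max_i min {n_j : j \<noteq> i}\<close>, with values in \<open>enat\<close> so that for \<open>m = 1\<close> the minimum of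
  the empty set is \<open>\<infinity>\<close>.\<close>

definition max_min_others :: "nat \<Rightarrow> (nat \<Rightarrow> nat) \<Rightarrow> enat" where
  "max_min_others m n = (MAX i\<in>{1..m}. INF j\<in>{1..m} - {i}. enat (n j))"

end

theory Submission
  imports Defs "HOL-Analysis.Kronecker_Approximation_Theorem"
begin

text \<open>Sort the dimensions increasingly and take as coefficients the products
  \<open>\<Prod>\<^sub>t H\<^sub>t(j\<^sub>t, j\<^sub>t\<^sub>+\<^sub>1)\<close> along the chain of factors, where \<open>H\<^sub>t\<close> is a corner of a Hadamard matrix of
  order between \<open>n\<^sub>t\<^sub>+\<^sub>1\<close> and \<open>(1 + \<delta>) n\<^sub>t\<^sub>+\<^sub>1\<close>. The form is then a product of diagonal contractions
  and matrices of operator norm at most \<open>((1 + \<delta>) n\<^sub>t\<^sub>+\<^sub>1)\<^sup>1\<^sup>/\<^sup>2\<close>, evaluated between vectors of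
  Euclidean norm at most \<open>n\<^sub>1\<^sup>1\<^sup>/\<^sup>2\<close> and \<open>n\<^sub>m\<^sup>1\<^sup>/\<^sup>2\<close>. Only \<open>n\<^sub>2, \<dots>, n\<^sub>m\<close> have to be large. Such orders exist
  because the tensor products of the Hadamard matrices of orders 2 and 12 have all orders
  \<open>2\<^sup>a 12\<^sup>c\<close>, and \<open>log\<^sub>2 12\<close> is irrational.\<close>

section \<open>Hadamard matrices\<close>

definition hadamard :: "nat \<Rightarrow> (nat \<Rightarrow> nat \<Rightarrow> int) \<Rightarrow> bool" where
  "hadamard h H \<longleftrightarrow>
     (\<forall>i<h. \<forall>j<h. H i j \<in> {-1, 1}) \<and>
     (\<forall>i<h. \<forall>k<h. (\<Sum>j<h. H i j * H k j) = (if i = k then int h else 0))"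

lemma hadamard_1: "hadamard 1 (\<lambda>i j. 1)"
  by (simp add: hadamard_def)

lemma hadamard_2: "hadamard 2 (\<lambda>i j. if i = 1 \<and> j = 1 then -1 else 1)"
  by (auto simp: hadamard_def less_2_cases_iff lessThan_Suc numeral_2_eq_2)

text \<open>The residues listed are the nonzero squares modulo 11 (Paley's construction).\<close>

definition paley12 :: "nat \<Rightarrow> nat \<Rightarrow> int" where
  "paley12 i j =
     (if i = 0 \<or> i = j \<or> j \<noteq> 0 \<and> (i + 11 - j) mod 11 \<in> {1, 3, 4, 5, 9} then 1 else - 1)"

lemma hadamard_12: "hadamard 12 paley12"
proof -
  \<comment> \<open>Orthogonality of the rows is a finite computation; lists in place of index sets
    make it executable by \<open>code_simp\<close>.\<close>
  have "\<forall>i\<in>set [0..<12]. \<forall>k\<in>set [0..<12].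
      sum_list (map (\<lambda>j. paley12 i j * paley12 k j) [0..<12]) = (if i = k then 12 else 0)"
    by code_simp
  then have "(\<Sum>j<12. paley12 i j * paley12 k j) = (if i = k then 12 else 0)"
    if "i < 12" "k < 12" for i k
    using that unfolding interv_sum_list_conv_sum_set_nat by (simp add: atLeast0LessThan)
  then show ?thesis
    by (simp add: hadamard_def paley12_def)
qed

text \<open>An index below \<open>h * g\<close> encodes the pair of its quotient and remainder by
  \<open>g\<close>. Summed block by block, the inner product of two rows factors into one inner
  product for \<open>H\<close> and one for \<open>G\<close>.\<close>

lemma hadamard_tensor:
  assumes H: "hadamard h H" and G: "hadamard g G"
  shows "hadamard (h * g) (\<lambda>i j. H (i div g) (j div g) * G (i mod g) (j mod g))"
proof -
  have div: "i div g < h" and mod: "i mod g < g" if "i < h * g" for i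
    using that by (cases "g = 0"; auto simp: less_mult_imp_div_less)+
  have "H (i div g) (j div g) * G (i mod g) (j mod g) \<in> {-1, 1}" if "i < h * g" "j < h * g" for i j
  proof -
    have "H (i div g) (j div g) \<in> {-1, 1}" "G (i mod g) (j mod g) \<in> {-1, 1}"
      using div[OF that(1)] div[OF that(2)] mod[OF that(1)] mod[OF that(2)] H G
      unfolding hadamard_def by blast+
    then show ?thesis
      by auto
  qed
  moreover have "(\<Sum>j<h * g. H (i div g) (j div g) * G (i mod g) (j mod g) *
      (H (k div g) (j div g) * G (k mod g) (j mod g))) = (if i = k then int (h * g) else 0)"
    if i: "i < h * g" and k: "k < h * g" for i k
  proof -
    have "(\<Sum>j<h * g. H (i div g) (j div g) * G (i mod g) (j mod g) *
        (H (k div g) (j div g) * G (k mod g) (j mod g))) =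
      (\<Sum>a<h. \<Sum>j\<in>{a * g..<a * g + g}. H (i div g) (j div g) * G (i mod g) (j mod g) *
        (H (k div g) (j div g) * G (k mod g) (j mod g)))"
      by (rule sum.nat_group[symmetric])
    also have "\<dots> = (\<Sum>a<h. \<Sum>b<g. H (i div g) a * G (i mod g) b * (H (k div g) a * G (k mod g) b))"
    proof (rule sum.cong[OF refl])
      fix a
      have div_mod: "j div g = a \<and> j mod g = j - a * g" if "j \<in> {a * g..<a * g + g}" for j
      proof -
        have "j div g = a"
          using that by (intro div_nat_eqI) (auto simp: algebra_simps)
        then show ?thesis
          by (simp flip: minus_div_mult_eq_mod)
      qed
      show "(\<Sum>j\<in>{a * g..<a * g + g}. H (i div g) (j div g) * G (i mod g) (j mod g) *
          (H (k div g) (j div g) * G (k mod g) (j mod g)))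
        = (\<Sum>b<g. H (i div g) a * G (i mod g) b * (H (k div g) a * G (k mod g) b))"
        by (rule sum.reindex_bij_witness[of _ "\<lambda>b. a * g + b" "\<lambda>j. j - a * g"]) (auto simp: div_mod)
    qed
    also have "\<dots> = (\<Sum>a<h. H (i div g) a * H (k div g) a) * (\<Sum>b<g. G (i mod g) b * G (k mod g) b)"
      unfolding sum_product by (simp add: mult_ac)
    also have "\<dots> = (if i div g = k div g then int h else 0) * (if i mod g = k mod g then int g else 0)"
      using H G div mod i k unfolding hadamard_def by simp
    also have "\<dots> = (if i = k then int (h * g) else 0)"
      by (cases "i = k") (auto, metis div_mult_mod_eq)
    finally show ?thesis .
  qed
  ultimately show ?thesis
    unfolding hadamard_def by blast
qed

lemma hadamard_2_12_powers: "\<exists>H. hadamard (2 ^ a * 12 ^ c) H"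
proof -
  have "\<exists>H. hadamard (2 ^ a) H"
    by (induction a) (use hadamard_1 in force, use hadamard_2 hadamard_tensor in fastforce)
  moreover have "\<exists>H. hadamard (12 ^ c) H"
    by (induction c) (use hadamard_1 in force, use hadamard_12 hadamard_tensor in fastforce)
  ultimately show ?thesis
    using hadamard_tensor by blast
qed

text \<open>After expansion into inner products, orthogonality of the rows kills the mixed terms.
  The sort covers real and complex scalars together, with \<open>inner\<close> the real inner
  product.\<close>

lemma norm_sum_of_int_mult_squared:
  fixes y :: "nat \<Rightarrow> 'a :: {real_normed_field, real_inner}"
  assumes "hadamard h H" and "a \<le> h"
  shows "(\<Sum>j<h. (norm (\<Sum>i<a. of_int (H i j) * y i))\<^sup>2) = real h * (\<Sum>i<a. (norm (y i))\<^sup>2)"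
proof -
  have inner_of_int: "inner (of_int c * x) (of_int d * x') = real_of_int (c * d) * inner x x'"
    for c d and x x' :: 'a
    using inner_scaleR_left[of "of_int c" x] inner_scaleR_right[of x "of_int d" x']
    by (simp add: scaleR_conv_of_real)
  have "(\<Sum>j<h. (norm (\<Sum>i<a. of_int (H i j) * y i))\<^sup>2)
      = (\<Sum>j<h. \<Sum>i<a. \<Sum>k<a. real_of_int (H k j * H i j) * inner (y k) (y i))"
    by (simp only: power2_norm_eq_inner inner_sum_left inner_sum_right inner_of_int)
  also have "\<dots> = (\<Sum>i<a. \<Sum>k<a. \<Sum>j<h. real_of_int (H k j * H i j) * inner (y k) (y i))"
    by (subst sum.swap, rule sum.cong[OF refl], rule sum.swap)
  also have "\<dots> = (\<Sum>i<a. \<Sum>k<a. real_of_int (\<Sum>j<h. H k j * H i j) * inner (y k) (y i))"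
    by (simp add: sum_distrib_right)
  also have "\<dots> = (\<Sum>i<a. \<Sum>k<a. if i = k then real h * (norm (y i))\<^sup>2 else 0)"
    using assms by (intro sum.cong) (auto simp: hadamard_def power2_norm_eq_inner)
  also have "\<dots> = real h * (\<Sum>i<a. (norm (y i))\<^sup>2)"
    by (simp add: sum_distrib_left)
  finally show ?thesis .
qed

section \<open>Density of the orders\<close>

lemma two_pow_neq_twelve_pow:
  assumes "q > 0"
  shows "(2::nat) ^ p \<noteq> 12 ^ q"
proof
  assume eq: "(2::nat) ^ p = 12 ^ q"
  have "(3::nat) dvd 12 ^ q"
    using assms by (intro dvd_power_le[of 3 12 1 q, simplified]) auto
  then have "(3::nat) dvd 2 ^ p"
    by (simp add: eq)
  moreover have "coprime (3::nat) (2 ^ p)"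
    using coprime_Suc_left_nat[of 2] by simp
  ultimately have "is_unit (3::nat)"
    by (metis coprime_absorb_left)
  then show False
    by simp
qed

text \<open>Exponentiating to base 2 would turn an equality into one between a power of 12 and a
  power of 2. Since the logarithm is positive, so is \<open>p\<close>, and both exponents become
  natural numbers.\<close>

lemma of_int_mult_log_2_12_neq_of_int:
  assumes "q > 0"
  shows "of_int q * log 2 12 \<noteq> of_int p"
proof
  assume eq: "of_int q * log 2 12 = of_int p"
  have "log 2 12 > 0"
    by simp
  then have "p > 0"
    using assms eq by (metis mult_pos_pos of_int_0_less_iff)
  have "(12::real) ^ nat q = 2 powr (log 2 12 * real (nat q))"
    by (simp add: powr_powr[symmetric] powr_realpow)
  also have "\<dots> = 2 ^ nat p"
    using assms eq \<open>p > 0\<close> by (simp add: mult.commute flip: powr_realpow)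
  finally have "(12::nat) ^ nat q = 2 ^ nat p"
    by (metis of_nat_eq_iff of_nat_numeral of_nat_power)
  then show False
    using two_pow_neq_twelve_pow[of "nat q" "nat p"] assms by simp
qed

text \<open>Dirichlet's theorem supplies an integer combination of \<open>\<theta>\<close> and \<open>1\<close> of absolute value less
  than \<open>\<eta>\<close>; a bounded multiple of it bridges the gap between \<open>x\<close> and a neighbouring integer.\<close>

lemma ex_nat_combination_between:
  fixes \<theta> \<eta> :: real
  assumes \<theta>: "\<And>q p :: int. q > 0 \<Longrightarrow> of_int q * \<theta> \<noteq> of_int p" and "\<eta> > 0"
  shows "\<exists>X. \<forall>x\<ge>X. \<exists>a c :: nat. x \<le> real a + real c * \<theta> \<and> real a + real c * \<theta> \<le> x + \<eta>"
proof -
  obtain M where "inverse (real (Suc M)) < \<eta>"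
    using reals_Archimedean[OF \<open>\<eta> > 0\<close>] by blast
  then have M: "Suc M > 0" "1 / real (Suc M) < \<eta>"
    by (simp_all add: inverse_eq_divide)
  obtain p q where q: "0 < q" and qp: "\<bar>of_int q * \<theta> - of_int p\<bar> < 1 / real (Suc M)"
    using Dirichlet_approx[OF M(1), of \<theta>] that by blast
  define \<tau> where "\<tau> = of_int q * \<theta> - of_int p"
  have \<tau>: "\<tau> \<noteq> 0" "\<bar>\<tau>\<bar> < \<eta>"
    using \<theta>[OF q, of p] qp M by (auto simp: \<tau>_def)
  \<comment> \<open>\<open>K\<close> bounds the number of steps of size \<bar>\<tau>\<bar> that fit
    into the walk across an interval of length at most 1. It does not depend on \<open>x\<close>, so
    the threshold for \<open>x\<close> is uniform.\<close>
  define K where "K = \<lceil>1 / \<bar>\<tau>\<bar>\<rceil>"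
  have "\<exists>a c :: nat. x \<le> real a + real c * \<theta> \<and> real a + real c * \<theta> \<le> x + \<eta>"
    if x: "x \<ge> of_int (K * \<bar>p\<bar>) + 1" for x
  proof -
    have "\<exists>d k. of_int d \<ge> x - 1 \<and> 0 \<le> k \<and> k \<le> K \<and> x \<le> of_int d + of_int k * \<tau> \<and>
        of_int d + of_int k * \<tau> \<le> x + \<eta>"
    \<comment> \<open>For positive \<tau> the walk goes up from the floor of \<open>x\<close> and
      overshoots \<open>x\<close> by at most \<tau>; otherwise it goes down from the ceiling of
      \<open>x\<close> and stops above \<open>x\<close>, within \<bar>\<tau>\<bar> of it.\<close>
    proof (cases "\<tau> > 0")
      case True
      define k where "k = \<lceil>(x - of_int \<lfloor>x\<rfloor>) / \<tau>\<rceil>"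
      have "(x - of_int \<lfloor>x\<rfloor>) / \<tau> \<le> 1 / \<tau>"
        using True by (intro divide_right_mono) linarith+
      then have "k \<le> K"
        using True by (simp add: k_def K_def ceiling_mono)
      moreover have "0 \<le> k"
        using True by (simp add: k_def) (smt (verit) divide_nonneg_pos of_int_floor_le)
      moreover have "(x - of_int \<lfloor>x\<rfloor>) / \<tau> \<le> of_int k" "of_int k \<le> (x - of_int \<lfloor>x\<rfloor>) / \<tau> + 1"
        by (auto simp: k_def of_int_ceiling_le_add_one)
      then have "x - of_int \<lfloor>x\<rfloor> \<le> of_int k * \<tau>" "of_int k * \<tau> \<le> x - of_int \<lfloor>x\<rfloor> + \<tau>"
        using True by (auto simp: field_simps)
      ultimately show ?thesis
        using \<tau>(2) True by (intro exI[of _ "\<lfloor>x\<rfloor>"] exI[of _ k]) linarith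
    next
      case False
      define k where "k = \<lfloor>(of_int \<lceil>x\<rceil> - x) / \<bar>\<tau>\<bar>\<rfloor>"
      have "\<bar>\<tau>\<bar> > 0"
        using \<tau>(1) by simp
      have "(of_int \<lceil>x\<rceil> - x) / \<bar>\<tau>\<bar> \<le> 1 / \<bar>\<tau>\<bar>"
        by (rule divide_right_mono) linarith+
      then have "k \<le> K"
        unfolding k_def K_def by linarith
      moreover have "0 \<le> k"
        using \<tau>(1) by (simp add: k_def)
      moreover have "of_int k \<le> (of_int \<lceil>x\<rceil> - x) / \<bar>\<tau>\<bar>" "(of_int \<lceil>x\<rceil> - x) / \<bar>\<tau>\<bar> \<le> of_int k + 1"
        by (auto simp: k_def)
      then have "of_int k * \<bar>\<tau>\<bar> \<le> of_int \<lceil>x\<rceil> - x" "of_int \<lceil>x\<rceil> - x \<le> of_int k * \<bar>\<tau>\<bar> + \<bar>\<tau>\<bar>"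
        using \<open>\<bar>\<tau>\<bar> > 0\<close> by (auto simp: field_simps)
      moreover have "of_int k * \<bar>\<tau>\<bar> = - (of_int k * \<tau>)"
        using False by simp
      ultimately show ?thesis
        using \<tau>(2) by (intro exI[of _ "\<lceil>x\<rceil>"] exI[of _ k]) linarith
    qed
    then obtain d k where dk: "of_int d \<ge> x - 1" "0 \<le> k" "k \<le> K"
        "x \<le> of_int d + of_int k * \<tau>" "of_int d + of_int k * \<tau> \<le> x + \<eta>"
      by blast
    \<comment> \<open>The coefficient \<open>d - k * p\<close> must be a natural number:
      \<open>d\<close> is at least \<open>x - 1\<close>, hence at least
      \<open>K * \<bar>p\<bar>\<close>, which dominates \<open>k * p\<close>.\<close>
    have "k * p \<le> k * \<bar>p\<bar>"
      using dk by (intro mult_left_mono) auto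
    also have "\<dots> \<le> K * \<bar>p\<bar>"
      using dk by (intro mult_right_mono) auto
    also have "of_int (K * \<bar>p\<bar>) \<le> (of_int d :: real)"
      using dk x by linarith
    then have "K * \<bar>p\<bar> \<le> d"
      by (simp only: of_int_le_iff)
    finally have "d - k * p \<ge> 0"
      by simp
    moreover have "of_int d + of_int k * \<tau> = of_int (d - k * p) + of_int (k * q) * \<theta>"
      by (simp add: \<tau>_def algebra_simps)
    ultimately show ?thesis
      using dk q by (intro exI[of _ "nat (d - k * p)"] exI[of _ "nat (k * q)"]) simp
  qed
  then show ?thesis
    by blast
qed

text \<open>In logarithms to base 2 the orders \<open>2 ^ a * 12 ^ c\<close> become
  \<open>a + c * log 2 12\<close>, and the relative accuracy \<open>1 + \<delta>\<close> becomes an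
  interval of fixed length \<open>log 2 (1 + \<delta>)\<close>.\<close>

lemma hadamard_order_dense:
  assumes "\<delta> > 0"
  shows "\<exists>N. \<forall>b>N. \<exists>h H. hadamard h H \<and> b \<le> h \<and> real h \<le> (1 + \<delta>) * real b"
proof -
  obtain X where X: "\<And>x. x \<ge> X \<Longrightarrow> \<exists>a c :: nat. x \<le> real a + real c * log 2 12 \<and>
      real a + real c * log 2 12 \<le> x + log 2 (1 + \<delta>)"
    using ex_nat_combination_between[OF of_int_mult_log_2_12_neq_of_int, of "log 2 (1 + \<delta>)"] assms
    by auto
  have "\<exists>h H. hadamard h H \<and> b \<le> h \<and> real h \<le> (1 + \<delta>) * real b" if "b > nat \<lceil>2 powr X\<rceil>" for b
  proof -
    have b: "real b > 2 powr X"
      using that by linarith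
    then have "real b > 0"
      by (smt (verit) powr_gt_zero)
    then have "log 2 (real b) \<ge> X"
      using b by (simp add: le_log_iff)
    then obtain a c where ac: "log 2 (real b) \<le> real a + real c * log 2 12"
        "real a + real c * log 2 12 \<le> log 2 (real b) + log 2 (1 + \<delta>)"
      using X by blast
    have "real (2 ^ a * 12 ^ c) = 2 powr (real a + real c * log 2 12)"
      by (simp add: powr_add powr_realpow mult.commute[of "real c"] powr_powr[symmetric])
    moreover have "real b \<le> 2 powr (real a + real c * log 2 12)"
      using ac(1) \<open>real b > 0\<close> by (simp add: log_le_iff)
    moreover have "2 powr (real a + real c * log 2 12) \<le> 2 powr (log 2 (real b) + log 2 (1 + \<delta>))"
      using ac(2) by simp
    moreover have "2 powr (log 2 (real b) + log 2 (1 + \<delta>)) = (1 + \<delta>) * real b"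
      using \<open>real b > 0\<close> assms by (simp add: powr_add)
    ultimately have "b \<le> 2 ^ a * 12 ^ c" "real (2 ^ a * 12 ^ c) \<le> (1 + \<delta>) * real b"
      by (simp_all only: of_nat_le_iff[symmetric, where 'a = real])
    then show ?thesis
      using hadamard_2_12_powers by blast
  qed
  then show ?thesis
    by blast
qed

text \<open>\<open>C\<close> bounds the square of a Euclidean operator norm. Since \<open>a\<close>
  ranges up to \<open>b\<close>, one square matrix serves every smaller dimension that may precede
  \<open>b\<close> in the chain. The type argument fixes the scalars.\<close>

definition sign_matrix_bound ::
  "'a :: real_normed_field itself \<Rightarrow> nat \<Rightarrow> real \<Rightarrow> (nat \<Rightarrow> nat \<Rightarrow> int) \<Rightarrow> bool" where
  "sign_matrix_bound _ b C H \<longleftrightarrow>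
     (\<forall>i\<in>{1..b}. \<forall>j\<in>{1..b}. H i j \<in> {-1, 1}) \<and>
     (\<forall>a\<le>b. \<forall>y :: nat \<Rightarrow> 'a.
        (\<Sum>j=1..b. (norm (\<Sum>i=1..a. of_int (H i j) * y i))\<^sup>2) \<le> C * (\<Sum>i=1..a. (norm (y i))\<^sup>2))"

text \<open>Keeping only the first \<open>b\<close> columns of a Hadamard matrix of order
  \<open>h\<close> discards nonnegative terms, and \<open>h\<close> is at most
  \<open>(1 + \<delta>) * b\<close>.\<close>

lemma ex_sign_matrix_bound:
  assumes "\<delta> > 0"
  shows "\<exists>N. \<forall>b>N. \<exists>H. sign_matrix_bound TYPE('a :: {real_normed_field, real_inner})
    b ((1 + \<delta>) * real b) H"
proof -
  have "\<exists>H. sign_matrix_bound TYPE('a) b ((1 + \<delta>) * real b) H"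
    if H: "hadamard h H" "b \<le> h" "real h \<le> (1 + \<delta>) * real b" for b h H
  \<comment> \<open>Hadamard matrices are indexed from 0, coordinates from 1.\<close>
  proof (intro exI[of _ "\<lambda>i j. H (i - 1) (j - 1)"], unfold sign_matrix_bound_def, intro conjI ballI allI impI)
    show "H (i - 1) (j - 1) \<in> {- 1, 1}" if "i \<in> {1..b}" "j \<in> {1..b}" for i j
    proof -
      have "i - 1 < h" "j - 1 < h"
        using that \<open>b \<le> h\<close> by auto
      then show ?thesis
        using H unfolding hadamard_def by blast
    qed
    fix a and y :: "nat \<Rightarrow> 'a"
    assume "a \<le> b"
    have "(\<Sum>j=1..b. (norm (\<Sum>i=1..a. of_int (H (i - 1) (j - 1)) * y i))\<^sup>2)
        = (\<Sum>j<b. (norm (\<Sum>i<a. of_int (H i j) * y (Suc i)))\<^sup>2)"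
      by (simp add: sum.atLeast1_atMost_eq)
    also have "\<dots> \<le> (\<Sum>j<h. (norm (\<Sum>i<a. of_int (H i j) * y (Suc i)))\<^sup>2)"
      using \<open>b \<le> h\<close> by (intro sum_mono2) auto
    also have "\<dots> = real h * (\<Sum>i<a. (norm (y (Suc i)))\<^sup>2)"
      using H \<open>a \<le> b\<close> by (intro norm_sum_of_int_mult_squared) auto
    also have "\<dots> \<le> (1 + \<delta>) * real b * (\<Sum>i<a. (norm (y (Suc i)))\<^sup>2)"
      using H by (intro mult_right_mono sum_nonneg) auto
    also have "(\<Sum>i<a. (norm (y (Suc i)))\<^sup>2) = (\<Sum>i=1..a. (norm (y i))\<^sup>2)"
      by (simp add: sum.atLeast1_atMost_eq)
    finally show "(\<Sum>j=1..b. (norm (\<Sum>i=1..a. of_int (H (i - 1) (j - 1)) * y i))\<^sup>2)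
        \<le> (1 + \<delta>) * real b * (\<Sum>i=1..a. (norm (y i))\<^sup>2)" .
  qed
  then show ?thesis
    using hadamard_order_dense[OF assms] by meson
qed

section \<open>Chaining sign matrices\<close>

lemma sum_PiE_insert:
  assumes "finite S" "\<And>l. l \<in> insert k S \<Longrightarrow> finite (T l)" "k \<notin> S"
  shows "(\<Sum>j\<in>Pi\<^sub>E (insert k S) T. f j) = (\<Sum>i\<in>T k. \<Sum>j\<in>Pi\<^sub>E S T. f (j(k := i)))"
proof -
  have "(\<Sum>j\<in>Pi\<^sub>E (insert k S) T. f j) = (\<Sum>(i, j)\<in>T k \<times> Pi\<^sub>E S T. f (j(k := i)))"
    unfolding PiE_insert_eq
    by (subst sum.reindex[OF inj_combinator[OF assms(3)]]) (simp add: case_prod_unfold)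
  then show ?thesis
    using assms by (simp add: sum.cartesian_product)
qed

text \<open>The induction keeps the form one step short of completion: the coordinate at
  \<open>k\<close>, the end of the chain, stays free, and the resulting vector of length
  \<open>n k\<close> is bounded in squared Euclidean norm. Each further index \<open>x\<close> costs
  a factor \<open>(1 + \<delta>) * n x\<close>. The index \<open>i0\<close> is the one whose
  dimension may be small.\<close>

lemma ex_sign_chain:
  fixes n :: "'k \<Rightarrow> nat"
  assumes "\<delta> > 0"
    and mat: "\<forall>b>N. \<exists>H. sign_matrix_bound TYPE('a :: real_normed_field) b ((1 + \<delta>) * real b) H"
    and "finite K" "K \<noteq> {}" "\<forall>l\<in>K - {i0}. n l > N"
  shows "\<exists>k\<in>K. (\<forall>l\<in>K. n l \<le> n k) \<and>
    (\<exists>s :: ('k \<Rightarrow> nat) \<Rightarrow> int. (\<forall>j\<in>(\<Pi>\<^sub>E l\<in>K. {1..n l}). s j \<in> {-1, 1}) \<and>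
      (\<forall>z :: 'k \<Rightarrow> nat \<Rightarrow> 'a. (\<forall>l\<in>K. \<forall>i\<in>{1..n l}. norm (z l i) \<le> 1) \<longrightarrow>
        (\<Sum>i=1..n k. (norm (\<Sum>j\<in>(\<Pi>\<^sub>E l\<in>K - {k}. {1..n l}).
            of_int (s (j(k := i))) * (\<Prod>l\<in>K - {k}. z l (j l))))\<^sup>2)
          \<le> (1 + \<delta>) ^ card K * (\<Prod>l\<in>K. real (n l))))"
  using assms(3-5)
\<comment> \<open>Indices arrive in order of nondecreasing dimension. The rule allows
  \<open>x\<close> to lie in \<open>S\<close> already, which is the first case below.\<close>
proof (induction K rule: finite_ranking_induct[where f = n])
  case empty
  then show ?case
    by simp
next
  case (insert x S)
  consider "x \<in> S" | "S = {}" | "x \<notin> S" "S \<noteq> {}"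
    by blast
  then show ?case
  proof cases
    case 1
    then show ?thesis
      using insert by (simp add: insert_absorb)
  next
    case 2
    \<comment> \<open>With a single index the inner sum has one term, equal to 1, so the claim
      reduces to this inequality.\<close>
    have "real (n x) \<le> (1 + \<delta>) * real (n x)"
      using \<open>\<delta> > 0\<close> by (simp add: mult_le_cancel_right1)
    then show ?thesis
      by (intro bexI[of _ x] conjI exI[of _ "\<lambda>_. 1"]) (auto simp: 2)
  next
    case 3
    have IH_prem: "\<forall>l\<in>S - {i0}. n l > N"
      using insert.prems by blast
    from insert.IH[OF 3(2) this] obtain k s where k: "k \<in> S" "\<forall>l\<in>S. n l \<le> n k"
      and s: "\<forall>j\<in>(\<Pi>\<^sub>E l\<in>S. {1..n l}). s j \<in> {-1, 1 :: int}"
      and bound: "\<And>z :: 'k \<Rightarrow> nat \<Rightarrow> 'a. (\<forall>l\<in>S. \<forall>i\<in>{1..n l}. norm (z l i) \<le> 1) \<Longrightarrow>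
        (\<Sum>i=1..n k. (norm (\<Sum>j\<in>(\<Pi>\<^sub>E l\<in>S - {k}. {1..n l}).
            of_int (s (j(k := i))) * (\<Prod>l\<in>S - {k}. z l (j l))))\<^sup>2)
          \<le> (1 + \<delta>) ^ card S * (\<Prod>l\<in>S. real (n l))"
      by blast
    \<comment> \<open>If \<open>i0\<close> arrives after another index, its dimension is at least
      that of \<open>k\<close>, which differs from \<open>i0\<close> and so already exceeds
      \<open>N\<close>.\<close>
    have "n x > N"
    proof (cases "x = i0")
      case True
      then have "n k > N"
        using IH_prem k 3 by blast
      then show ?thesis
        using insert.hyps(2)[OF k(1)] by simp
    qed (use insert.prems in blast)
    then obtain H where H: "sign_matrix_bound TYPE('a) (n x) ((1 + \<delta>) * real (n x)) H"
      using mat by blast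
    \<comment> \<open>The new sign couples the old end \<open>k\<close> of the chain with the new
      end \<open>x\<close>. Extensional functions are \<open>undefined\<close> outside their domain,
      so \<open>j(x := undefined)\<close> is the restriction of \<open>j\<close> to
      \<open>S\<close>.\<close>
    define s' where "s' j = H (j k) (j x) * s (j(x := undefined))" for j
    have "x \<noteq> k"
      using 3 k by blast
    have s': "s' j \<in> {-1, 1}" if j: "j \<in> (\<Pi>\<^sub>E l\<in>insert x S. {1..n l})" for j
    proof -
      have "j(x := undefined) \<in> (\<Pi>\<^sub>E l\<in>S. {1..n l})"
        using j 3 by (auto simp: PiE_iff extensional_def)
      moreover have "j k \<in> {1..n k}" "j x \<in> {1..n x}"
        using j k by (auto simp: PiE_iff)
      moreover have "n k \<le> n x"
        using insert.hyps k by blast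
      ultimately have "H (j k) (j x) \<in> {-1, 1}" "s (j(x := undefined)) \<in> {-1, 1}"
        using H s unfolding sign_matrix_bound_def by auto
      then show ?thesis
        by (auto simp: s'_def)
    qed
    have step: "(\<Sum>i'=1..n x. (norm (\<Sum>j\<in>(\<Pi>\<^sub>E l\<in>insert x S - {x}. {1..n l}).
            of_int (s' (j(x := i'))) * (\<Prod>l\<in>insert x S - {x}. z l (j l))))\<^sup>2)
          \<le> (1 + \<delta>) ^ card (insert x S) * (\<Prod>l\<in>insert x S. real (n l))"
      if z: "\<forall>l\<in>insert x S. \<forall>i\<in>{1..n l}. norm (z l i) \<le> 1" for z :: "'k \<Rightarrow> nat \<Rightarrow> 'a"
    proof -
      define v where "v i = (\<Sum>j\<in>(\<Pi>\<^sub>E l\<in>S - {k}. {1..n l}).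
            of_int (s (j(k := i))) * (\<Prod>l\<in>S - {k}. z l (j l)))" for i
      \<comment> \<open>Summation over the old free coordinate shows that the new vector is
        \<open>H\<close>, summed over its row index, applied to the entrywise product of
        \<open>z k\<close> and the old vector \<open>v\<close>.\<close>
      have eq: "(\<Sum>j\<in>(\<Pi>\<^sub>E l\<in>S. {1..n l}). of_int (s' (j(x := i'))) * (\<Prod>l\<in>S. z l (j l)))
          = (\<Sum>i=1..n k. of_int (H i i') * (z k i * v i))" for i'
      proof -
        have S: "S = insert k (S - {k})"
          using k by blast
        have "(\<Sum>j\<in>(\<Pi>\<^sub>E l\<in>S. {1..n l}). of_int (s' (j(x := i'))) * (\<Prod>l\<in>S. z l (j l)))
          = (\<Sum>i=1..n k. \<Sum>j\<in>(\<Pi>\<^sub>E l\<in>S - {k}. {1..n l}).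
              of_int (s' (j(k := i, x := i'))) * (\<Prod>l\<in>S. z l ((j(k := i)) l)))"
          using insert.hyps by (subst S, subst sum_PiE_insert) auto
        also have "\<dots> = (\<Sum>i=1..n k. \<Sum>j\<in>(\<Pi>\<^sub>E l\<in>S - {k}. {1..n l}).
              of_int (H i i') * (z k i * (of_int (s (j(k := i))) * (\<Prod>l\<in>S - {k}. z l (j l)))))"
        proof (intro sum.cong refl)
          fix i j
          assume j: "j \<in> (\<Pi>\<^sub>E l\<in>S - {k}. {1..n l})"
          have "j x = undefined"
            using j 3 by (auto simp: PiE_iff extensional_def)
          then have "j(k := i, x := undefined) = j(k := i)"
            using \<open>x \<noteq> k\<close> by auto
          then have "s' (j(k := i, x := i')) = H i i' * s (j(k := i))"
            using \<open>x \<noteq> k\<close> by (simp add: s'_def)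
          moreover have "(\<Prod>l\<in>S. z l ((j(k := i)) l)) = z k i * (\<Prod>l\<in>S - {k}. z l (j l))"
            using k insert.hyps by (simp add: prod.remove)
          ultimately show "of_int (s' (j(k := i, x := i'))) * (\<Prod>l\<in>S. z l ((j(k := i)) l)) =
            of_int (H i i') * (z k i * (of_int (s (j(k := i))) * (\<Prod>l\<in>S - {k}. z l (j l))))"
            by simp
        qed
        finally show ?thesis
          by (simp add: v_def sum_distrib_left)
      qed
      \<comment> \<open>Three bounds in turn: the matrix with \<open>a = n k\<close>, at most
        \<open>n x\<close> by the ranking; the diagonal contraction by \<open>z k\<close>; the
        induction hypothesis for \<open>v\<close>.\<close>
      have "(\<Sum>i'=1..n x. (norm (\<Sum>i=1..n k. of_int (H i i') * (z k i * v i)))\<^sup>2)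
          \<le> (1 + \<delta>) * real (n x) * (\<Sum>i=1..n k. (norm (z k i * v i))\<^sup>2)"
        using H[unfolded sign_matrix_bound_def, THEN conjunct2, rule_format,
            of "n k" "\<lambda>i. z k i * v i"] insert.hyps(2)[OF k(1)] by simp
      also have "\<dots> \<le> (1 + \<delta>) * real (n x) * (\<Sum>i=1..n k. (norm (v i))\<^sup>2)"
        using z k \<open>\<delta> > 0\<close>
        by (intro mult_left_mono sum_mono power_mono) (auto simp: norm_mult mult_left_le_one_le)
      also have "\<dots> \<le> (1 + \<delta>) * real (n x) * ((1 + \<delta>) ^ card S * (\<Prod>l\<in>S. real (n l)))"
        unfolding v_def using z \<open>\<delta> > 0\<close> by (intro mult_left_mono bound) auto
      also have "\<dots> = (1 + \<delta>) ^ card (insert x S) * (\<Prod>l\<in>insert x S. real (n l))"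
        using 3 insert.hyps by simp
      finally show ?thesis
        using 3 by (simp add: eq del: One_nat_def)
    qed
    have "\<forall>l\<in>insert x S. n l \<le> n x"
      using insert.hyps(2) by blast
    then show ?thesis
      by (intro bexI[of _ x] conjI exI[of _ s'] ballI allI impI)
        (blast, rule s', assumption, rule step, assumption, simp)
  qed
qed

section \<open>The multilinear form\<close>

lemma multilinear_form_sum_prod:
  "multilinear_form m n (\<lambda>z :: nat \<Rightarrow> nat \<Rightarrow> 'a :: real_normed_field.
     \<Sum>j\<in>J. c j * (\<Prod>k\<in>{1..m}. z k (j k)))"
proof -
  have split: "(\<Prod>l\<in>{1..m}. (x(k := w)) l (j l)) = w (j k) * (\<Prod>l\<in>{1..m} - {k}. x l (j l))"
    if "k \<in> {1..m}" for x :: "nat \<Rightarrow> nat \<Rightarrow> 'a" and w k and j :: "nat \<Rightarrow> nat"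
    using that by (simp add: prod.remove)
  show ?thesis
    unfolding multilinear_form_def
    by (intro ballI allI conjI)
       (simp_all add: split algebra_simps sum.distrib sum_distrib_left del: fun_upd_apply One_nat_def)
qed

lemma form_norm_le:
  fixes A :: "(nat \<Rightarrow> nat \<Rightarrow> 'a :: real_normed_field) \<Rightarrow> 'a"
  assumes n: "\<And>k. k \<in> {1..m} \<Longrightarrow> n k \<ge> 1"
    and B: "\<And>z. (\<forall>k\<in>{1..m}. \<forall>i\<in>{1..n k}. norm (z k i) \<le> 1) \<Longrightarrow> norm (A z) \<le> B"
  shows "form_norm m n A \<le> B"
  unfolding form_norm_def
proof (rule cSUP_least)
  \<comment> \<open>The supremum needs a nonempty domain, witnessed by the zero tuple;
    \<open>n k \<ge> 1\<close> keeps the maximum in \<open>linf_norm\<close> over a nonempty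
    set.\<close>
  have "restrict (\<lambda>_ _. 0) {1..m} \<in>
      {x \<in> linf_prod m n. \<forall>k\<in>{1..m}. linf_norm (n k) (x k) \<le> (1 :: real)}"
    using n by (auto simp: linf_prod_def linf_space_def linf_norm_def)
  then show "{x \<in> linf_prod m n. \<forall>k\<in>{1..m}. linf_norm (n k) (x k :: nat \<Rightarrow> 'a) \<le> 1} \<noteq> {}"
    by blast
next
  fix x :: "nat \<Rightarrow> nat \<Rightarrow> 'a"
  assume x: "x \<in> {x \<in> linf_prod m n. \<forall>k\<in>{1..m}. linf_norm (n k) (x k) \<le> 1}"
  have "norm (x k i) \<le> 1" if "k \<in> {1..m}" "i \<in> {1..n k}" for k i
  proof -
    have "norm (x k i) \<le> linf_norm (n k) (x k)"
      unfolding linf_norm_def using that by (intro Max_ge) auto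
    then show ?thesis
      using x that by fastforce
  qed
  then show "norm (A x) \<le> B"
    using B by blast
qed

text \<open>The index attaining the outer maximum serves as \<open>i0\<close>. For
  \<open>m = 1\<close> the infimum is infinite and the conclusion about the other indices is
  vacuous.\<close>

lemma max_min_others_gtE:
  assumes "m \<ge> 1" "max_min_others m n > enat N"
  obtains i0 where "\<forall>l\<in>{1..m} - {i0}. n l > N"
proof -
  have "max_min_others m n \<in> (\<lambda>i. INF j\<in>{1..m} - {i}. enat (n j)) ` {1..m}"
    unfolding max_min_others_def using assms(1) by (intro Max_in) auto
  then obtain i0 where i0: "enat N < (INF j\<in>{1..m} - {i0}. enat (n j))"
    using assms(2) by auto
  have "n l > N" if "l \<in> {1..m} - {i0}" for l
    using less_le_trans[OF i0 INF_lower[OF that]] by simp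
  then show ?thesis
    using that by blast
qed

text \<open>Real and complex scalars are instances of the same sort, so one proof yields both halves
  of the theorem. The chain bound leaves the coordinate \<open>k\<close> free; Cauchy-Schwarz closes
  the form there.\<close>

lemma ex_sign_form:
  fixes m :: nat and \<epsilon> :: real
  assumes "m \<ge> 1" and "\<epsilon> > 0"
  shows "\<exists>N\<ge>1. \<forall>n :: nat \<Rightarrow> nat.
        (\<forall>i\<in>{1..m}. n i \<ge> 1) \<and> max_min_others m n > enat N \<longrightarrow>
        (\<exists>A :: (nat \<Rightarrow> nat \<Rightarrow> 'a :: {real_normed_field, real_inner}) \<Rightarrow> 'a.
           multilinear_form m n A \<and> sign_type m n A \<and>
           form_norm m n A
             \<le> (1 + \<epsilon>) * (MAX i\<in>{1..m}. sqrt (real (n i))) * (\<Prod>j\<in>{1..m}. sqrt (real (n j))))"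
proof -
  \<comment> \<open>The chain bound concerns a squared norm and carries the factor
    \<open>(1 + \<delta>) ^ m\<close>, which is to equal
    \<open>(1 + \<epsilon>)\<^sup>2\<close>.\<close>
  define \<delta> where "\<delta> = root m ((1 + \<epsilon>)\<^sup>2) - 1"
  have "\<delta> > 0"
    using assms by (simp add: \<delta>_def)
  have \<delta>_pow: "(1 + \<delta>) ^ m = (1 + \<epsilon>)\<^sup>2"
    using assms by (simp add: \<delta>_def)
  obtain N where N: "\<forall>b>N. \<exists>H. sign_matrix_bound TYPE('a) b ((1 + \<delta>) * real b) H"
    using ex_sign_matrix_bound[OF \<open>\<delta> > 0\<close>] by blast
  have "\<exists>A :: (nat \<Rightarrow> nat \<Rightarrow> 'a) \<Rightarrow> 'a. multilinear_form m n A \<and> sign_type m n A \<and>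
      form_norm m n A
        \<le> (1 + \<epsilon>) * (MAX i\<in>{1..m}. sqrt (real (n i))) * (\<Prod>j\<in>{1..m}. sqrt (real (n j)))"
    if n: "\<forall>i\<in>{1..m}. n i \<ge> 1" and large: "max_min_others m n > enat (max N 1)" for n
  proof -
    obtain i0 where "\<forall>l\<in>{1..m} - {i0}. n l > max N 1"
      using max_min_others_gtE[OF assms(1) large] .
    then have i0: "\<forall>l\<in>{1..m} - {i0}. n l > N"
      by auto
    have fin: "finite {1..m}" "{1..m} \<noteq> {}"
      using assms by auto
    obtain k s where k: "k \<in> {1..m}" "\<forall>l\<in>{1..m}. n l \<le> n k"
      and s: "\<forall>j\<in>(\<Pi>\<^sub>E l\<in>{1..m}. {1..n l}). s j \<in> {-1, 1 :: int}"
      and bound: "\<forall>z :: nat \<Rightarrow> nat \<Rightarrow> 'a. (\<forall>l\<in>{1..m}. \<forall>i\<in>{1..n l}. norm (z l i) \<le> 1) \<longrightarrow>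
        (\<Sum>i=1..n k. (norm (\<Sum>j\<in>(\<Pi>\<^sub>E l\<in>{1..m} - {k}. {1..n l}).
            of_int (s (j(k := i))) * (\<Prod>l\<in>{1..m} - {k}. z l (j l))))\<^sup>2)
          \<le> (1 + \<delta>) ^ card {1..m} * (\<Prod>l\<in>{1..m}. real (n l))"
      using ex_sign_chain[OF \<open>\<delta> > 0\<close> N fin i0] by (elim bexE conjE exE) (rule that)
    define A where "A z = (\<Sum>j\<in>(\<Pi>\<^sub>E l\<in>{1..m}. {1..n l}). of_int (s j) * (\<Prod>l\<in>{1..m}. z l (j l)))"
      for z :: "nat \<Rightarrow> nat \<Rightarrow> 'a"
    have "multilinear_form m n A"
      unfolding A_def by (rule multilinear_form_sum_prod)
    moreover have "sign_type m n A"
      unfolding sign_type_def A_def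
      by (rule exI[of _ "\<lambda>j. of_int (s j)"]) (use s in fastforce)
    moreover have "form_norm m n A
        \<le> (1 + \<epsilon>) * (MAX i\<in>{1..m}. sqrt (real (n i))) * (\<Prod>j\<in>{1..m}. sqrt (real (n j)))"
    proof (rule form_norm_le)
      show "n l \<ge> 1" if "l \<in> {1..m}" for l
        using n that by blast
      fix z :: "nat \<Rightarrow> nat \<Rightarrow> 'a"
      assume z: "\<forall>l\<in>{1..m}. \<forall>i\<in>{1..n l}. norm (z l i) \<le> 1"
      define v where "v i = (\<Sum>j\<in>(\<Pi>\<^sub>E l\<in>{1..m} - {k}. {1..n l}).
            of_int (s (j(k := i))) * (\<Prod>l\<in>{1..m} - {k}. z l (j l)))" for i
      have ins: "{1..m} = insert k ({1..m} - {k})"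
        using k by blast
      have prod: "(\<Prod>l\<in>{1..m}. z l ((j(k := i)) l)) = z k i * (\<Prod>l\<in>{1..m} - {k}. z l (j l))" for i j
        using k by (simp add: prod.remove)
      have "A z = (\<Sum>i=1..n k. \<Sum>j\<in>(\<Pi>\<^sub>E l\<in>{1..m} - {k}. {1..n l}).
          of_int (s (j(k := i))) * (\<Prod>l\<in>{1..m}. z l ((j(k := i)) l)))"
        unfolding A_def by (subst ins, subst sum_PiE_insert) auto
      also have "\<dots> = (\<Sum>i=1..n k. z k i * v i)"
        by (simp only: prod) (simp add: v_def sum_distrib_left algebra_simps)
      finally have "norm (A z) \<le> (\<Sum>i=1..n k. norm (z k i * v i))"
        by (simp add: norm_sum)
      also have "\<dots> \<le> (\<Sum>i=1..n k. norm (v i))"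
        using z k by (intro sum_mono) (auto simp: norm_mult mult_left_le_one_le)
      \<comment> \<open>The explicit factor 1 sets up Cauchy-Schwarz against the constant vector.
        The resulting \<open>n k\<close> is the source of the maximum in the final bound.\<close>
      finally have "(norm (A z))\<^sup>2 \<le> (\<Sum>i=1..n k. 1 * norm (v i))\<^sup>2"
        by (simp add: power_mono)
      also have "\<dots> \<le> real (n k) * (\<Sum>i=1..n k. (norm (v i))\<^sup>2)"
        using Cauchy_Schwarz_ineq_sum[of "\<lambda>_. 1" "\<lambda>i. norm (v i)" "{1..n k}"] by simp
      also have "\<dots> \<le> real (n k) * ((1 + \<epsilon>)\<^sup>2 * (\<Prod>l\<in>{1..m}. real (n l)))"
        using bound[THEN spec, THEN mp, OF z] unfolding v_def by (intro mult_left_mono) (auto simp: \<delta>_pow)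
      also have "\<dots> = ((1 + \<epsilon>) * sqrt (real (n k)) * (\<Prod>l\<in>{1..m}. sqrt (real (n l))))\<^sup>2"
        by (simp add: power_mult_distrib prod_power_distrib)
      finally have "norm (A z) \<le> (1 + \<epsilon>) * sqrt (real (n k)) * (\<Prod>l\<in>{1..m}. sqrt (real (n l)))"
        by (rule power2_le_imp_le) (use assms in \<open>auto intro!: mult_nonneg_nonneg prod_nonneg\<close>)
      also have "sqrt (real (n k)) \<le> (MAX i\<in>{1..m}. sqrt (real (n i)))"
        using k by (intro Max_ge) auto
      finally show "norm (A z)
          \<le> (1 + \<epsilon>) * (MAX i\<in>{1..m}. sqrt (real (n i))) * (\<Prod>j\<in>{1..m}. sqrt (real (n j)))"
        using assms by (simp add: mult_right_mono mult_left_mono prod_nonneg)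
    qed
    ultimately show ?thesis
      by blast
  qed
  then show ?thesis
    \<comment> \<open>The threshold has to be positive, hence the maximum with 1.\<close>
    by (intro exI[of _ "max N 1"]) auto
qed

theorem theorem3p9:
  fixes m :: nat and \<epsilon> :: real
  assumes "m \<ge> 1" and "\<epsilon> > 0"
  shows
    "(\<exists>N\<ge>1. \<forall>n :: nat \<Rightarrow> nat.
        (\<forall>i\<in>{1..m}. n i \<ge> 1) \<and> max_min_others m n > enat N \<longrightarrow>
        (\<exists>A :: (nat \<Rightarrow> nat \<Rightarrow> real) \<Rightarrow> real.
           multilinear_form m n A \<and> sign_type m n A \<and>
           form_norm m n A
             \<le> (1 + \<epsilon>) * (MAX i\<in>{1..m}. sqrt (real (n i))) * (\<Prod>j\<in>{1..m}. sqrt (real (n j))))) \<and>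
     (\<exists>N\<ge>1. \<forall>n :: nat \<Rightarrow> nat.
        (\<forall>i\<in>{1..m}. n i \<ge> 1) \<and> max_min_others m n > enat N \<longrightarrow>
        (\<exists>A :: (nat \<Rightarrow> nat \<Rightarrow> complex) \<Rightarrow> complex.
           multilinear_form m n A \<and> sign_type m n A \<and>
           form_norm m n A
             \<le> (1 + \<epsilon>) * (MAX i\<in>{1..m}. sqrt (real (n i))) * (\<Prod>j\<in>{1..m}. sqrt (real (n j)))))"
  by (rule conjI; rule ex_sign_form[OF assms])

end
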